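(* Let $q=p^r$ with $p$ prime, let $k\geqslant 2$, and let $0\leqslant j\leqslant q-2$ be such that the class $C_j$ has exactly two elements. Let $M_j$ be the $2\times 2$ matrix of the Atkin operator $U_t$ restricted to the span of $C_j$. If it is not the case that [$q$ is even, $k$ is odd and $M_j$ is antidiagonal (i.e. both diagonal entries of $M_j$ are zero)], then $M_j$ is diagonalizable over $\mathbb{C}_\infty$.
   Context: Let $A=\mathbb{F}_q[t]$, $F_\infty=\mathbb{F}_q((1/t))$, $\mathbb{C}_\infty$ the completion of an algebraic closure of $F_\infty$, and $\Omega=\mathbb{P}^1(\mathbb{C}_\infty)-\mathbb{P}^1(F_\infty)$ the Drinfeld upper half plane (a rigid analytic space). Let $\Gamma_1(t)=\{\gamma\in GL_2(A):\gamma\equiv\left(\begin{smallmatrix}1&*\\0&1\end{smallmatrix}\right)\pmod t\}$ (all its elements have determinant $1$). $S^1_k(\Gamma_1(t))$ denotes the $\mathbb{C}_\infty$-space of Drinfeld cusp forms of weight $k$ for $\Gamma_1(t)$: rigid analytic $f:\Omega\to\mathbb{C}_\infty$ with $f(\gamma z)(cz+d)^{-k}=f(z)$ for all $\gamma=\left(\begin{smallmatrix}a&b\\c&d\end{smallmatrix}\right)\in\Gamma_1(t)$, holomorphic and vanishing at all cusps. The Atkin operator is $U_t(f)(z)=\sum_{\beta\in\mathbb{F}_q}f\big(\frac{z+\beta}{t}\big)$ (up to a nonzero normalizing scalar). Via Teitelbaum's isomorphism with $\Gamma_1(t)$-equivariant harmonic cocycles on the Bruhat–Tits tree, $S^1_k(\Gamma_1(t))$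 has dimension $k-1$ and a basis $c_0,\dots,c_{k-2}$ (where $c_j$ is the cocycle whose value on the unique stable edge $\overline{e}$ of the fundamental domain satisfies $c_j(\overline{e})(X^iY^{k-2-i})=\delta_{ij}$), on which $$U_t(c_j)=-(-t)^{j+1}\binom{k-2-j}{j}c_j-t^{j+1}\sum_{h\neq 0}\left[\binom{k-2-j-h(q-1)}{-h(q-1)}+(-1)^{j+1}\binom{k-2-j-h(q-1)}{j}\right]c_{j+h(q-1)},$$ with the convention $c_i=0$ if $i<0$ or $i>k-2$, binomial coefficients $\binom{n}{m}$ taken as integers reduced into $\mathbb{F}_p\subset\mathbb{C}_\infty$ and equal to $0$ if $m<0$ or $m>n$. For $0\leqslant j\leqslant q-2$, $C_j=\{c_\ell:0\leqslant \ell\leqslant k-2,\ \ell\equiv j\pmod{q-1}\}$; the span of $C_j$ is $U_t$-stable and $M_j$ is the matrix of $U_t$ on it in the basis $C_j$ ordered by increasing $\ell$. *)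

theory Defs
  imports
    "HOL-Library.Cardinality"
    "HOL-Library.Function_Algebras"
    "HOL-Computational_Algebra.Formal_Laurent_Series"
    "Jordan_Normal_Form.Matrix"
    "Jordan_Normal_Form.Determinant"
begin

text \<open>
  The finite field \<open>\<bbbF>\<^sub>q\<close> is a type \<open>'a\<close> of classes \<open>field\<close> and \<open>finite\<close>, with \<open>q = CARD('a)\<close>.
  The ring \<open>A = \<bbbF>\<^sub>q[t]\<close> is \<open>'a poly\<close>, and \<open>F\<^sub>\<infinity> = \<bbbF>\<^sub>q((1/t))\<close> is \<open>'a fls\<close>. The formal variable of
  \<open>'a fls\<close> stands for \<open>1/t\<close>, so that \<open>t\<close> itself is \<open>fls_X_inv\<close>.

  The field \<open>\<complex>\<^sub>\<infinity>\<close> is a type \<open>'c\<close> together with an embedding \<open>\<iota> :: 'a fls \<Rightarrow> 'c\<close> and an absolute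
  value \<open>av :: 'c \<Rightarrow> real\<close>.
\<close>


section \<open>The field of values\<close>

definition av_tendsto :: "('c::field \<Rightarrow> real) \<Rightarrow> (nat \<Rightarrow> 'c) \<Rightarrow> 'c \<Rightarrow> bool" where
  "av_tendsto av s l \<longleftrightarrow> (\<lambda>n. av (s n - l)) \<longlonglongrightarrow> 0"

definition av_Cauchy :: "('c::field \<Rightarrow> real) \<Rightarrow> (nat \<Rightarrow> 'c) \<Rightarrow> bool" where
  "av_Cauchy av s \<longleftrightarrow> (\<forall>\<epsilon>>0. \<exists>N. \<forall>m\<ge>N. \<forall>n\<ge>N. av (s m - s n) < \<epsilon>)"

definition algebraic_elements :: "('a::field fls \<Rightarrow> 'c::field) \<Rightarrow> 'c set" where
  "algebraic_elements \<iota> = {x. \<exists>p :: 'a fls poly. p \<noteq> 0 \<and> poly (map_poly \<iota> p) x = 0}"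

text \<open>
  \<open>('c, \<iota>, av)\<close> is the completion of an algebraic closure of \<open>F\<^sub>\<infinity>\<close>: it is complete, and the elements
  algebraic over \<open>F\<^sub>\<infinity>\<close> form an algebraically closed and dense subfield. The absolute value is
  normalised by \<open>|t| = q\<close>.
\<close>

definition is_C_infinity :: "('a::{field,finite} fls \<Rightarrow> 'c::field) \<Rightarrow> ('c \<Rightarrow> real) \<Rightarrow> bool" where
  "is_C_infinity \<iota> av \<longleftrightarrow>
     \<comment> \<open>field embedding\<close>
     \<iota> 1 = 1 \<and> (\<forall>x y. \<iota> (x + y) = \<iota> x + \<iota> y) \<and> (\<forall>x y. \<iota> (x * y) = \<iota> x * \<iota> y) \<and>
     \<comment> \<open>non-archimedean absolute value extending the one of \<open>F\<^sub>\<infinity>\<close>\<close>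
     (\<forall>x. 0 \<le> av x) \<and> (\<forall>x. av x = 0 \<longleftrightarrow> x = 0) \<and> (\<forall>x y. av (x * y) = av x * av y) \<and>
     (\<forall>x y. av (x + y) \<le> max (av x) (av y)) \<and>
     (\<forall>x. x \<noteq> 0 \<longrightarrow> av (\<iota> x) = real CARD('a) powi (- fls_subdegree x)) \<and>
     \<comment> \<open>completeness\<close>
     (\<forall>s. av_Cauchy av s \<longrightarrow> (\<exists>l. av_tendsto av s l)) \<and>
     \<comment> \<open>the algebraic elements form an algebraic closure of \<open>F\<^sub>\<infinity>\<close>\<close>
     (\<forall>p. (\<forall>i. coeff p i \<in> algebraic_elements \<iota>) \<and> degree p > 0 \<longrightarrow>
          (\<exists>x\<in>algebraic_elements \<iota>. poly p x = 0)) \<and>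
     \<comment> \<open>which is dense\<close>
     (\<forall>x. \<forall>\<epsilon>>0. \<exists>y\<in>algebraic_elements \<iota>. av (x - y) < \<epsilon>)"

definition const_C :: "('a::field fls \<Rightarrow> 'c::field) \<Rightarrow> 'a \<Rightarrow> 'c" where
  "const_C \<iota> \<beta> = \<iota> (fls_const \<beta>)"

definition t_C :: "('a::field fls \<Rightarrow> 'c::field) \<Rightarrow> 'c" where
  "t_C \<iota> = \<iota> fls_X_inv"

definition A_C :: "('a::field fls \<Rightarrow> 'c::field) \<Rightarrow> 'a poly \<Rightarrow> 'c" where
  "A_C \<iota> p = poly (map_poly (const_C \<iota>) p) (t_C \<iota>)"


section \<open>The Drinfeld upper half plane and rigid analytic functions\<close>

definition Omega :: "('a::field fls \<Rightarrow> 'c::field) \<Rightarrow> 'c set" where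
  "Omega \<iota> = - range \<iota>"

text \<open>The imaginary absolute value \<open>|z|\<^sub>i\<close>, i.e. the distance of \<open>z\<close> from \<open>F\<^sub>\<infinity>\<close>.\<close>

definition im_av :: "('a::field fls \<Rightarrow> 'c::field) \<Rightarrow> ('c \<Rightarrow> real) \<Rightarrow> 'c \<Rightarrow> real" where
  "im_av \<iota> av z = (INF x. av (z - \<iota> x))"

text \<open>
  The sets \<open>\<Omega>\<^sub>n\<close> below are the usual admissible covering of \<open>\<Omega>\<close> by connected affinoids; a function on
  such an affinoid is rigid analytic iff it is a uniform limit of rational functions without poles
  there.
\<close>

definition Omega_aff :: "('a::{field,finite} fls \<Rightarrow> 'c::field) \<Rightarrow> ('c \<Rightarrow> real) \<Rightarrow> nat \<Rightarrow> 'c set" where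
  "Omega_aff \<iota> av n =
     {z. av z \<le> real CARD('a) ^ n \<and> im_av \<iota> av z \<ge> 1 / real CARD('a) ^ n}"

definition rigid_analytic ::
  "('a::{field,finite} fls \<Rightarrow> 'c::field) \<Rightarrow> ('c \<Rightarrow> real) \<Rightarrow> ('c \<Rightarrow> 'c) \<Rightarrow> bool" where
  "rigid_analytic \<iota> av f \<longleftrightarrow>
     (\<forall>n. \<forall>\<epsilon>>0. \<exists>P Q :: 'c poly. \<forall>z\<in>Omega_aff \<iota> av n.
        poly Q z \<noteq> 0 \<and> av (f z - poly P z / poly Q z) < \<epsilon>)"


section \<open>Drinfeld cusp forms for \<open>\<Gamma>\<^sub>1(t)\<close>\<close>

definition GL2A :: "'a::field poly mat set" where
  "GL2A = {\<gamma> \<in> carrier_mat 2 2. is_unit (det \<gamma>)}"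

definition Gamma1t :: "'a::field poly mat set" where
  "Gamma1t = {\<gamma> \<in> GL2A. [:0, 1:] dvd \<gamma> $$ (0,0) - 1 \<and> [:0, 1:] dvd \<gamma> $$ (1,0) \<and>
                         [:0, 1:] dvd \<gamma> $$ (1,1) - 1}"

definition slash ::
  "('a::field fls \<Rightarrow> 'c::field) \<Rightarrow> nat \<Rightarrow> ('c \<Rightarrow> 'c) \<Rightarrow> 'a poly mat \<Rightarrow> 'c \<Rightarrow> 'c" where
  "slash \<iota> k f \<gamma> z =
     (let num = A_C \<iota> (\<gamma> $$ (0,0)) * z + A_C \<iota> (\<gamma> $$ (0,1));
          den = A_C \<iota> (\<gamma> $$ (1,0)) * z + A_C \<iota> (\<gamma> $$ (1,1))
      in f (num / den) / den ^ k)"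

text \<open>
  The lattice of translations in \<open>\<gamma>\<^sup>-\<^sup>1 \<Gamma>\<^sub>1(t) \<gamma>\<close>, that is, the group of periods of \<open>f|\<gamma>\<close>. There is no
  further diagonal part to take into account: an upper triangular element of \<open>\<gamma>\<^sup>-\<^sup>1 \<Gamma>\<^sub>1(t) \<gamma>\<close> is
  unipotent.
\<close>

definition cusp_lattice :: "'a::field poly mat \<Rightarrow> 'a poly set" where
  "cusp_lattice \<gamma> = {b. \<exists>\<delta>\<in>Gamma1t. \<delta> * \<gamma> = \<gamma> * mat_of_rows_list 2 [[1, b], [0, 1]]}"

text \<open>The exponential function of a lattice \<open>L \<subseteq> A\<close>, and the resulting parameter at infinity.\<close>

definition lattice_exp ::
  "('a::{field,finite} fls \<Rightarrow> 'c::field) \<Rightarrow> ('c \<Rightarrow> real) \<Rightarrow> 'a poly set \<Rightarrow> 'c \<Rightarrow> 'c" where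
  "lattice_exp \<iota> av L z =
     (THE w. av_tendsto av (\<lambda>n. z * (\<Prod>b\<in>{b\<in>L. b \<noteq> 0 \<and> degree b < n}. 1 - z / A_C \<iota> b)) w)"

definition cusp_parameter ::
  "('a::{field,finite} fls \<Rightarrow> 'c::field) \<Rightarrow> ('c \<Rightarrow> real) \<Rightarrow> 'a poly set \<Rightarrow> 'c \<Rightarrow> 'c" where
  "cusp_parameter \<iota> av L z = 1 / lattice_exp \<iota> av L z"

text \<open>
  Every cusp of \<open>\<Gamma>\<^sub>1(t)\<close> is \<open>\<gamma>(\<infinity>)\<close> for some \<open>\<gamma> \<in> GL\<^sub>2(A)\<close>. Holomorphic and vanishing there means that, for
  \<open>|z|\<^sub>i\<close> large, \<open>f|\<gamma>\<close> is a power series without constant term in the parameter.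
\<close>

definition vanishes_at_cusp ::
  "('a::{field,finite} fls \<Rightarrow> 'c::field) \<Rightarrow> ('c \<Rightarrow> real) \<Rightarrow> nat \<Rightarrow> ('c \<Rightarrow> 'c) \<Rightarrow> 'a poly mat \<Rightarrow> bool"
  where
  "vanishes_at_cusp \<iota> av k f \<gamma> \<longleftrightarrow>
     (\<exists>(a :: nat \<Rightarrow> 'c) R. \<forall>z\<in>Omega \<iota>. im_av \<iota> av z > R \<longrightarrow>
        av_tendsto av
          (\<lambda>m. \<Sum>n=1..m. a n * cusp_parameter \<iota> av (cusp_lattice \<gamma>) z ^ n) (slash \<iota> k f \<gamma> z))"

text \<open>Functions on \<open>\<Omega>\<close> are represented as functions on \<open>\<complex>\<^sub>\<infinity>\<close> that are zero outside \<open>\<Omega>\<close>.\<close>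

definition cusp_forms ::
  "('a::{field,finite} fls \<Rightarrow> 'c::field) \<Rightarrow> ('c \<Rightarrow> real) \<Rightarrow> nat \<Rightarrow> ('c \<Rightarrow> 'c) set" where
  "cusp_forms \<iota> av k =
     {f. (\<forall>z. z \<notin> Omega \<iota> \<longrightarrow> f z = 0) \<and>
         rigid_analytic \<iota> av f \<and>
         (\<forall>\<gamma>\<in>Gamma1t. \<forall>z\<in>Omega \<iota>. slash \<iota> k f \<gamma> z = f z) \<and>
         (\<forall>\<gamma>\<in>GL2A. vanishes_at_cusp \<iota> av k f \<gamma>)}"

definition fscale :: "'c::field \<Rightarrow> ('c \<Rightarrow> 'c) \<Rightarrow> 'c \<Rightarrow> 'c" where
  "fscale a f = (\<lambda>z. a * f z)"

interpretation funs: vector_space fscale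
  by unfold_locales (auto simp: fscale_def fun_eq_iff algebra_simps)

definition atkin_U :: "('a::{field,finite} fls \<Rightarrow> 'c::field) \<Rightarrow> ('c \<Rightarrow> 'c) \<Rightarrow> 'c \<Rightarrow> 'c" where
  "atkin_U \<iota> f z = (\<Sum>\<beta>\<in>UNIV. f ((z + const_C \<iota> \<beta>) / t_C \<iota>))"


section \<open>The basis of Teitelbaum's isomorphism\<close>

text \<open>
  The stabilisers in \<open>\<Gamma>\<^sub>1(t)\<close> of the vertices given by the discs \<open>|z| \<le> 1\<close> and \<open>|z| \<le> 1/q\<close> consist of
  the translations by \<open>\<bbbF>\<^sub>q\<close> and of the maps \<open>z \<mapsto> z/(atz + 1)\<close> with \<open>a \<in> \<bbbF>\<^sub>q\<close>. They intersect trivially, so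
  the edge joining these vertices is the stable one. The corresponding annulus is \<open>1/q < |z| < 1\<close>.
  The function \<open>a :: int \<Rightarrow> 'c\<close> gives the coefficients of a Laurent expansion there.
\<close>

definition stable_edge_annulus :: "('a::{field,finite} fls \<Rightarrow> 'c) \<Rightarrow> ('c \<Rightarrow> real) \<Rightarrow> 'c set" where
  "stable_edge_annulus \<iota> av = {z. 1 / real CARD('a) < av z \<and> av z < 1}"

definition has_Laurent_expansion_on ::
  "('c::field \<Rightarrow> real) \<Rightarrow> ('c \<Rightarrow> 'c) \<Rightarrow> (int \<Rightarrow> 'c) \<Rightarrow> 'c set \<Rightarrow> bool" where
  "has_Laurent_expansion_on av f a D \<longleftrightarrow>
     (\<forall>z\<in>D. \<exists>u v. av_tendsto av (\<lambda>m. \<Sum>n=0..m. a (int n) * z ^ n) u \<and>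
                  av_tendsto av (\<lambda>m. \<Sum>n=1..m. a (- int n) / z ^ n) v \<and>
                  f z = u + v)"

text \<open>
  Teitelbaum's isomorphism sends \<open>f\<close> to the harmonic cocycle with value
  \<open>X\<^sup>i Y\<^sup>k\<^sup>-\<^sup>2\<^sup>-\<^sup>i \<mapsto> Res\<^sub>e z\<^sup>i f(z) dz\<close> on the edge \<open>e\<close>. On the stable edge this is the Laurent coefficient of
  index \<open>-i-1\<close>. (Reversing the orientation of the edge would multiply all the \<open>c\<^sub>j\<close> by \<open>-1\<close>.)
  The family \<open>c\<close> is only relevant for the indices \<open>0, \<dots>, k-2\<close>.
\<close>

definition cocycle_value_on_stable_edge ::
  "('a::{field,finite} fls \<Rightarrow> 'c::field) \<Rightarrow> ('c \<Rightarrow> real) \<Rightarrow> nat \<Rightarrow> ('c \<Rightarrow> 'c) \<Rightarrow> (nat \<Rightarrow> 'c) \<Rightarrow> bool"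
  where
  "cocycle_value_on_stable_edge \<iota> av k f r \<longleftrightarrow>
     (\<exists>a. has_Laurent_expansion_on av f a (stable_edge_annulus \<iota> av) \<and>
          (\<forall>i\<le>k-2. a (- int i - 1) = r i))"

definition Teitelbaum_basis ::
  "('a::{field,finite} fls \<Rightarrow> 'c::field) \<Rightarrow> ('c \<Rightarrow> real) \<Rightarrow> nat \<Rightarrow> (nat \<Rightarrow> 'c \<Rightarrow> 'c) \<Rightarrow> bool" where
  "Teitelbaum_basis \<iota> av k c \<longleftrightarrow>
     inj_on c {..k-2} \<and> funs.independent (c ` {..k-2}) \<and>
     funs.span (c ` {..k-2}) = cusp_forms \<iota> av k \<and>
     (\<forall>j\<le>k-2. cocycle_value_on_stable_edge \<iota> av k (c j) (\<lambda>i. if i = j then 1 else 0))"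


section \<open>The matrix of the Atkin operator\<close>

definition ibinom :: "int \<Rightarrow> int \<Rightarrow> nat" where
  "ibinom n m = (if 0 \<le> m \<and> m \<le> n then nat n choose nat m else 0)"

text \<open>
  The right-hand side of the formula for \<open>U\<^sub>t(c\<^sub>j)\<close>. The convention \<open>c\<^sub>i = 0\<close> for \<open>i < 0\<close> or \<open>i > k-2\<close>
  is expressed by restricting the range of \<open>h\<close>.
\<close>

definition atkin_formula ::
  "('a::{field,finite} fls \<Rightarrow> 'c::field) \<Rightarrow> nat \<Rightarrow> (nat \<Rightarrow> 'c \<Rightarrow> 'c) \<Rightarrow> nat \<Rightarrow> 'c \<Rightarrow> 'c" where
  "atkin_formula \<iota> k c j =
     (let q = int CARD('a); T = t_C \<iota>; K = int k - 2 - int j in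
      fscale (- ((- T) ^ (j+1)) * of_nat (ibinom K (int j))) (c j)
      - (\<Sum>h\<in>{h::int. h \<noteq> 0 \<and> 0 \<le> int j + h * (q - 1) \<and> int j + h * (q - 1) \<le> int k - 2}.
           fscale (T ^ (j+1) *
               (of_nat (ibinom (K - h * (q - 1)) (- h * (q - 1)))
                + (-1) ^ (j+1) * of_nat (ibinom (K - h * (q - 1)) (int j))))
             (c (nat (int j + h * (q - 1))))))"

text \<open>The indices \<open>\<ell>\<close> of the elements \<open>c\<^sub>\<ell>\<close> of the class \<open>C\<^sub>j\<close>.\<close>

definition class_indices :: "nat \<Rightarrow> nat \<Rightarrow> nat \<Rightarrow> nat set" where
  "class_indices q k j = {l. l \<le> k - 2 \<and> l mod (q - 1) = j mod (q - 1)}"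

text \<open>Columns are the coordinates of the images of the basis vectors.\<close>

definition atkin_matrix ::
  "('a::{field,finite} fls \<Rightarrow> 'c::field) \<Rightarrow> nat \<Rightarrow> (nat \<Rightarrow> 'c \<Rightarrow> 'c) \<Rightarrow> nat \<Rightarrow> 'c mat" where
  "atkin_matrix \<iota> k c j =
     (let I = class_indices CARD('a) k j; ls = sorted_list_of_set I in
      mat (card I) (card I)
        (\<lambda>(a, b). funs.representation (c ` I) (atkin_U \<iota> (c (ls ! b))) (c (ls ! a))))"

definition diagonalizable_mat :: "'c::field mat \<Rightarrow> bool" where
  "diagonalizable_mat M \<longleftrightarrow> (\<exists>D. diagonal_mat D \<and> similar_mat M D)"

end

theory Submission
  imports Defs
begin

text \<open>
  A class with two elements is \<open>{j, j + m}\<close> with \<open>m = q - 1\<close>, and then \<open>c\<^sub>j\<^sub>+\<^sub>m\<close> does not occur in its own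
  image, so the matrix is \<open>((a, b), (c, 0))\<close>. Up to a square, its discriminant is
  \<open>\<alpha>\<^sup>2 \<plusminus> 4t\<^sup>m\<beta>\<gamma>\<close> with \<open>\<alpha>, \<beta>, \<gamma>\<close> in the prime field. If it is nonzero there are two distinct
  eigenvalues. Otherwise \<open>\<alpha> = 0\<close> and \<open>4\<beta>\<gamma> = 0\<close>, because \<open>m > 0\<close>. By Lucas' theorem \<open>\<alpha> = 0\<close> forces
  \<open>\<beta> = \<plusminus>\<gamma>\<close>, so for odd \<open>q\<close> the matrix is zero. For even \<open>q\<close> and even \<open>k\<close>, the identity
  \<open>j C(s,j) = (s - j + 1) C(s,j-1)\<close> modulo 2 shows \<open>\<gamma> = 0\<close> as well.
\<close>

section \<open>Binomial coefficients modulo a prime\<close>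

text \<open>From \<open>l * (p^r choose l) = p^r * ((p^r - 1) choose (l - 1))\<close>: a binomial
  coefficient prime to \<open>p\<close> would force \<open>p^r\<close> to divide the smaller number
  \<open>l\<close>.\<close>

lemma prime_dvd_prime_power_choose:
  fixes p :: nat
  assumes "prime p" "0 < l" "l < p ^ r"
  shows "p dvd (p ^ r choose l)"
proof (rule ccontr)
  assume "\<not> p dvd (p ^ r choose l)"
  hence "coprime (p ^ r) (p ^ r choose l)"
    using assms(1) by (simp add: prime_imp_coprime)
  moreover have "l * (p ^ r choose l) = p ^ r * ((p ^ r - 1) choose (l - 1))"
    using assms by (intro times_binomial_minus1_eq) auto
  hence "p ^ r dvd l * (p ^ r choose l)"
    by simp
  ultimately have "p ^ r dvd l"
    by (simp add: coprime_dvd_mult_left_iff)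
  with assms show False
    by (auto dest: dvd_imp_le)
qed

lemma of_nat_choose_prime_power_eq_0:
  assumes "prime CHAR('c::comm_ring_1)" "0 < l" "l < CHAR('c) ^ r"
  shows "of_nat (CHAR('c) ^ r choose l) = (0 :: 'c)"
  using prime_dvd_prime_power_choose[OF assms] by (simp add: of_nat_eq_0_iff_char_dvd)

text \<open>Coefficientwise this is \<open>(1 + X)^(q + u) = (1 + X^q) * (1 + X)^u\<close> in
  characteristic p: only the terms \<open>l = 0\<close> and \<open>l = q\<close> of Vandermonde's
  sum survive.\<close>

lemma of_nat_choose_prime_power_add:
  assumes "prime CHAR('c::comm_ring_1)" and q: "q = CHAR('c) ^ r"
  shows "of_nat ((q + u) choose i) =
           (of_nat (u choose i) + (if q \<le> i then of_nat (u choose (i - q)) else 0) :: 'c)"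
proof -
  have "q > 0"
    using assms by (simp add: prime_gt_0_nat)
  have "of_nat ((q + u) choose i) = (\<Sum>l\<le>i. of_nat (q choose l) * of_nat (u choose (i - l)) :: 'c)"
    by (simp flip: vandermonde)
  also have "\<dots> = (\<Sum>l\<in>{0, q} \<inter> {..i}. of_nat (q choose l) * of_nat (u choose (i - l)))"
  proof (rule sum.mono_neutral_right; (intro ballI)?)
    fix l assume "l \<in> {..i} - {0, q} \<inter> {..i}"
    hence "l \<noteq> 0" "l \<noteq> q"
      by auto
    hence "of_nat (q choose l) = (0 :: 'c)"
      using of_nat_choose_prime_power_eq_0[OF assms(1), of l r] q
      by (cases "l < q") (auto simp: binomial_eq_0)
    thus "of_nat (q choose l) * of_nat (u choose (i - l)) = (0 :: 'c)"
      by simp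
  qed auto
  also have "{0, q} \<inter> {..i} = (if q \<le> i then {0, q} else {0})"
    by auto
  finally show ?thesis
    using \<open>q > 0\<close> by auto
qed

text \<open>Pascal's rule together with \<open>q choose Suc i = 0\<close> makes neighbouring entries
  of row \<open>q - 1\<close> opposite, starting from 1.\<close>

lemma of_nat_choose_pred_prime_power:
  assumes "prime CHAR('c::comm_ring_1)" and q: "q = CHAR('c) ^ r"
  shows "i < q \<Longrightarrow> of_nat ((q - 1) choose i) = ((-1) ^ i :: 'c)"
proof (induction i)
  case (Suc i)
  have "q choose Suc i = ((q - 1) choose i) + ((q - 1) choose Suc i)"
    using Suc.prems by (cases q) auto
  moreover have "of_nat (q choose Suc i) = (0 :: 'c)"
    using of_nat_choose_prime_power_eq_0[OF assms(1), of "Suc i" r] Suc.prems q by simp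
  ultimately have "(-1) ^ i + of_nat ((q - 1) choose Suc i) = (0 :: 'c)"
    using Suc by (metis Suc_lessD of_nat_add)
  thus ?case
    by (simp add: add_eq_0_iff)
qed simp

lemma even_choose_pred:
  assumes "even (n choose Suc i)" "odd (n + i)"
  shows "even (n choose i)"
proof (cases "i \<le> n")
  case True
  have "Suc i * (n choose Suc i) = (n - i) * (n choose i)"
    using Suc_times_binomial_add[of i "n - i - 1"] True by (cases "i = n") (auto simp: Suc_diff_Suc)
  moreover have "odd (n - i)"
    using True assms(2) by simp
  ultimately show ?thesis
    using assms(1) by (metis even_mult_iff)
qed (simp add: binomial_eq_0)

text \<open>
  By Lucas' theorem, writing \<open>K = q + s\<close>, the three coefficients are \<open>C(s,j)\<close>,
  \<open>(-1)\<^sup>j\<^sup>+\<^sup>q C(s,j-1)\<close> and \<open>C(s,j) + C(s,j-1)\<close>. For \<open>K = q - 1\<close> the first is \<open>(-1)\<^sup>j\<close>.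
\<close>

lemma off_diagonal_coefficients_eq:
  assumes char: "prime CHAR('c::idom)" and q: "q = CHAR('c) ^ r"
    and K: "q - 1 \<le> K" "K < 2 * (q - 1)" and j: "j \<le> q - 2"
    and zero: "of_nat (K choose j) = (0 :: 'c)"
  shows "of_nat (K choose (q - 1)) + (-1) ^ (j + q) * of_nat (K choose (j + (q - 1))) =
           ((-1) ^ (j + q) * of_nat ((K - (q - 1)) choose j) :: 'c)" (is ?thesis1)
    and "even q \<Longrightarrow> even (K + j) \<Longrightarrow> of_nat ((K - (q - 1)) choose j) = (0 :: 'c)" (is "_ \<Longrightarrow> _ \<Longrightarrow> ?thesis2")
proof -
  note add = of_nat_choose_prime_power_add[OF char q]
  have "K \<noteq> q - 1"
  proof
    assume "K = q - 1"
    moreover from this have "j < q"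
      using j K by linarith
    ultimately have "(-1) ^ j = (0 :: 'c)"
      using of_nat_choose_pred_prime_power[OF char q, of j] zero by simp
    thus False
      by simp
  qed
  then obtain s where s: "K = q + s" "s < q - 2" "K - (q - 1) = Suc s"
    using K by (intro that[of "K - q"]) auto
  have sj: "of_nat (s choose j) = (0 :: 'c)"
    using zero s(2) j add[of s j] unfolding s(1) by (simp split: if_splits)
  \<comment> \<open>\<open>s choose 0 = 1\<close> is nonzero, so \<open>j\<close> is
    positive.\<close>
  then obtain i where i: "j = Suc i"
    by (cases j) auto
  have "of_nat (K choose (q - 1)) = (0 :: 'c)"
    using s(2) unfolding s(1) add by (simp add: binomial_eq_0)
  \<comment> \<open>Here \<open>j + (q - 1) = q + i\<close>, so the second summand of
    \<open>add\<close> gives \<open>s choose i\<close>; the first, \<open>s choose (q + i)\<close>,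
    vanishes because \<open>s < q\<close>.\<close>
  moreover have "of_nat (K choose (j + (q - 1))) = (of_nat (s choose i) :: 'c)"
    using s(2) i unfolding s(1) add by (simp add: binomial_eq_0)
  moreover have eq: "of_nat ((K - (q - 1)) choose j) = (of_nat (s choose i) :: 'c)"
    using sj unfolding s(3) i by simp
  ultimately show ?thesis1
    by simp
  assume "even q" "even (K + j)"
  hence "CHAR('c) = 2"
    using char q by (metis dvd_power_same even_power odd_one prime_nat_iff' primes_dvd_imp_eq two_is_prime_nat)
  moreover have "odd (s + i)"
    using \<open>even q\<close> \<open>even (K + j)\<close> s i by simp
  ultimately show ?thesis2
    using sj even_choose_pred[of s i] unfolding eq by (simp add: of_nat_eq_0_iff_char_dvd i)
qed

section \<open>Diagonalizability of matrices of size two\<close>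

text \<open>For diagonal \<open>D\<close> the equation \<open>M * P = P * D\<close> says that the
  columns of \<open>P\<close> are eigenvectors. The inverse of \<open>P\<close> is its adjugate
  divided by \<open>det P\<close>.\<close>

lemma similar_mat_eigenbasis:
  fixes M P D :: "'c::field mat"
  assumes M [simp]: "M \<in> carrier_mat n n" and [simp]: "P \<in> carrier_mat n n" "D \<in> carrier_mat n n"
    and MP: "M * P = P * D" and det: "det P \<noteq> 0"
  shows "similar_mat M D"
proof -
  define Q where "Q = (1 / det P) \<cdot>\<^sub>m adj_mat P"
  have [simp]: "Q \<in> carrier_mat n n" "adj_mat P \<in> carrier_mat n n"
    using adj_mat(1)[of P n] by (auto simp: Q_def)
  have smult: "(1 / det P) \<cdot>\<^sub>m (det P \<cdot>\<^sub>m 1\<^sub>m n) = 1\<^sub>m n"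
    using det by (intro eq_matI) auto
  have PQ: "P * Q = 1\<^sub>m n" "Q * P = 1\<^sub>m n"
    using smult adj_mat(2,3)[of P n]
    by (simp_all add: Q_def mult_smult_distrib[of _ n n _ n] mult_smult_assoc_mat[of _ n n _ n])
  have "M = M * (P * Q)"
    by (simp add: PQ right_mult_one_mat[OF M])
  also have "\<dots> = P * D * Q"
    by (simp flip: assoc_mult_mat[of _ n n _ n _ n] add: MP)
  finally show ?thesis
    by (rule similar_matI[OF _ PQ, rotated]) simp
qed

lemma mat_2_eqI:
  assumes "A \<in> carrier_mat 2 2" "B \<in> carrier_mat 2 2"
    and "A $$ (0,0) = B $$ (0,0)" "A $$ (0,1) = B $$ (0,1)"
    and "A $$ (1,0) = B $$ (1,0)" "A $$ (1,1) = B $$ (1,1)"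
  shows "A = B"
  using assms by (intro eq_matI) (auto simp: less_2_cases_iff)

lemma det_carrier_mat_2:
  assumes "A \<in> carrier_mat 2 2"
  shows "det A = A $$ (0,0) * A $$ (1,1) - A $$ (0,1) * A $$ (1,0)"
proof -
  have "det (mat_delete A 0 i) = A $$ (1, 1 - i)" if "i < 2" for i
  proof -
    have "mat_delete A 0 i \<in> carrier_mat 1 1"
      using mat_delete_carrier[OF assms] by simp
    hence "det (mat_delete A 0 i) = mat_delete A 0 i $$ (0, 0)"
      by (rule det_single)
    also have "\<dots> = A $$ (1, 1 - i)"
      using that assms by (auto simp: mat_delete_def less_2_cases_iff)
    finally show ?thesis .
  qed
  moreover have "det A = (\<Sum>i<2. A $$ (0,i) * cofactor A 0 i)"
    by (rule laplace_expansion_row[OF assms]) simp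
  ultimately show ?thesis
    by (simp add: cofactor_def lessThan_nat_numeral lessThan_Suc)
qed

lemma diagonalizable_mat_diagonal:
  assumes "M \<in> carrier_mat n n" "diagonal_mat M"
  shows "diagonalizable_mat M"
  using assms similar_mat_refl unfolding diagonalizable_mat_def by blast

text \<open>By Vieta, \<open>x\<close> and \<open>y\<close> are the roots of the characteristic
  polynomial; eigenvectors for them are written down explicitly.\<close>

lemma diagonalizable_mat_2:
  fixes M :: "'c::field mat"
  assumes M: "M \<in> carrier_mat 2 2"
    and "x \<noteq> y" and tr: "x + y = M $$ (0,0) + M $$ (1,1)"
    and dt: "x * y = M $$ (0,0) * M $$ (1,1) - M $$ (0,1) * M $$ (1,0)"
  shows "diagonalizable_mat M"
proof -
  define a b c d where abcd: "a = M $$ (0,0)" "b = M $$ (0,1)" "c = M $$ (1,0)" "d = M $$ (1,1)"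
  let ?mat = "\<lambda>a b c d. mat_of_rows_list 2 [[a, b], [c, d]] :: 'c mat"
  have Meq: "M = ?mat a b c d"
    using M by (intro mat_2_eqI) (auto simp: abcd mat_of_rows_list_def numeral_2_eq_2)
  have carr: "?mat a b c d \<in> carrier_mat 2 2" for a b c d
    by (simp add: mat_of_rows_list_def numeral_2_eq_2)
  have prod: "?mat a b c d * ?mat a' b' c' d' =
      ?mat (a * a' + b * c') (a * b' + b * d') (c * a' + d * c') (c * b' + d * d')"
    for a b c d a' b' c' d'
    by (rule mat_2_eqI[OF mult_carrier_mat[OF carr carr] carr])
       (simp_all add: mat_of_rows_list_def scalar_prod_def numeral_2_eq_2)
  have det: "det (?mat a b c d) = a * d - b * c" for a b c d
    by (subst det_carrier_mat_2[OF carr]) (auto simp: mat_of_rows_list_def numeral_2_eq_2)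
  have D: "diagonal_mat (?mat x 0 0 y)"
    by (auto simp: diagonal_mat_def mat_of_rows_list_def numeral_2_eq_2 less_Suc_eq)
  have bc: "b * c = a * d - x * y" "c * b = a * d - x * y" and d: "d = x + y - a"
    using tr dt unfolding abcd[symmetric] by (simp_all add: algebra_simps)
  have *: ?thesis if "M * P = P * ?mat x 0 0 y" "det P \<noteq> 0" "P \<in> carrier_mat 2 2" for P
    using similar_mat_eigenbasis[OF M that(3) carr that(1,2)] D
    unfolding diagonalizable_mat_def by blast
  consider "b \<noteq> 0" | "c \<noteq> 0" | "b = 0" "c = 0"
    by blast
  thus ?thesis
  proof cases
    case 1
    show ?thesis
    \<comment> \<open>The first row of \<open>M - x\<close> annihilates \<open>(b, x - a)\<close>,
      and likewise for \<open>y\<close>. The determinant is \<open>b * (y - x)\<close>.\<close>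
    proof (rule *[of "?mat b b (x - a) (y - a)"])
      show "det (?mat b b (x - a) (y - a)) \<noteq> 0"
        using 1 \<open>x \<noteq> y\<close> unfolding det by (simp flip: right_diff_distrib)
      have "a * b + b * (x - a) = b * x" "a * b + b * (y - a) = b * y"
        by (simp_all add: algebra_simps)
      moreover have "c * b + d * (x - a) = (x - a) * x" "c * b + d * (y - a) = (y - a) * y"
        by (simp_all only: bc) (simp_all add: d algebra_simps)
      ultimately show "M * ?mat b b (x - a) (y - a) = ?mat b b (x - a) (y - a) * ?mat x 0 0 y"
        unfolding Meq prod by simp
    qed (rule carr)
  next
    case 2
    show ?thesis
    \<comment> \<open>The second row of \<open>M - x\<close> annihilates \<open>(x - d, c)\<close>,
      and likewise for \<open>y\<close>. The determinant is \<open>c * (x - y)\<close>.\<close>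
    proof (rule *[of "?mat (x - d) (y - d) c c"])
      show "det (?mat (x - d) (y - d) c c) \<noteq> 0"
        using 2 \<open>x \<noteq> y\<close> unfolding det by (simp flip: left_diff_distrib)
      have "c * (x - d) + d * c = c * x" "c * (y - d) + d * c = c * y"
        by (simp_all add: algebra_simps)
      moreover have "a * (x - d) + b * c = (x - d) * x" "a * (y - d) + b * c = (y - d) * y"
        by (simp_all only: bc) (simp_all add: d algebra_simps)
      ultimately show "M * ?mat (x - d) (y - d) c c = ?mat (x - d) (y - d) c c * ?mat x 0 0 y"
        unfolding Meq prod by simp
    qed (rule carr)
  next
    case 3
    thus ?thesis
      using M by (intro diagonalizable_mat_diagonal[of M 2])
        (auto simp: diagonal_mat_def less_2_cases_iff abcd)
  qed
qed

section \<open>Consequences of the axioms of the field of values\<close>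

lemma is_C_infinity_field_hom:
  assumes "is_C_infinity \<iota> av"
  shows "field_hom \<iota>"
proof -
  have hom: "\<iota> 1 = 1" "\<iota> (x + y) = \<iota> x + \<iota> y" "\<iota> (x * y) = \<iota> x * \<iota> y" for x y
    using assms by (simp_all add: is_C_infinity_def)
  moreover have "\<iota> 0 = 0"
    using hom(2)[of 0 0] by (metis add_0 add_cancel_right_right)
  ultimately show ?thesis
    by unfold_locales
qed

lemma (in field_hom) CHAR_hom: "CHAR('b) = CHAR('a)"
proof (rule CHAR_eqI)
  show "of_nat CHAR('a) = (0 :: 'b)"
    by (metis hom_of_nat hom_zero of_nat_CHAR)
  show "CHAR('a) dvd n" if "of_nat n = (0 :: 'b)" for n
    using that by (metis hom_0_iff hom_of_nat of_nat_eq_0_iff_char_dvd)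
qed

text \<open>Translation by 1 permutes the field, so summing all elements before and after it gives
  \<open>of_nat CARD('a) = 0\<close>.\<close>

lemma CHAR_eq_if_CARD_prime_power:
  assumes "prime p" "CARD('a::{field,finite}) = p ^ r"
  shows "CHAR('a) = p"
proof -
  have "prime CHAR('a)"
    using finite_imp_CHAR_pos[where 'a = 'a] by (simp add: prime_CHAR_semidom)
  moreover have "(\<Sum>x\<in>UNIV. x + 1 :: 'a) = (\<Sum>x\<in>UNIV. x)"
    by (rule sum.reindex_bij_betw[of "\<lambda>x. x + 1"]) (rule bij_betwI[of _ _ _ "\<lambda>x. x - 1"], auto)
  hence "of_nat CARD('a) = (0 :: 'a)"
    by (simp add: sum.distrib)
  hence "CHAR('a) dvd p ^ r"
    using assms(2) by (simp only: of_nat_eq_0_iff_char_dvd)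
  ultimately show ?thesis
    using assms(1) by (meson prime_dvd_power primes_dvd_imp_eq)
qed

text \<open>The closedness axiom covers only polynomials with coefficients algebraic over the
  Laurent series field. This suffices, as the image of \<open>\<iota>\<close> is algebraic.\<close>

lemma is_C_infinity_quadratic_root:
  assumes "is_C_infinity \<iota> av"
  obtains x where "x * x = \<iota> u * x + \<iota> v"
proof -
  interpret field_hom \<iota>
    using assms by (rule is_C_infinity_field_hom)
  have alg: "\<iota> w \<in> algebraic_elements \<iota>" for w
    unfolding algebraic_elements_def
    by (rule CollectI, rule exI[of _ "[:- w, 1:]"]) (simp add: map_poly_pCons hom_uminus)
  have closed: "(\<forall>i. coeff p i \<in> algebraic_elements \<iota>) \<and> degree p > 0 \<longrightarrow>
      (\<exists>x\<in>algebraic_elements \<iota>. poly p x = 0)" for p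
    using assms unfolding is_C_infinity_def by (elim conjE) (erule spec)
  have "\<exists>x\<in>algebraic_elements \<iota>. poly [:- \<iota> v, - \<iota> u, 1:] x = 0"
  proof -
    have "\<forall>i. coeff [:- \<iota> v, - \<iota> u, 1:] i \<in> algebraic_elements \<iota>"
      using alg[of "- v"] alg[of "- u"] alg[of 1] alg[of 0]
      by (auto simp: coeff_pCons hom_distribs split: nat.splits)
    thus ?thesis
      using closed by (simp del: poly_pCons)
  qed
  then obtain x where "poly [:- \<iota> v, - \<iota> u, 1:] x = 0"
    by blast
  hence "x * x = \<iota> u * x + \<iota> v"
    by (simp add: algebra_simps)
  thus ?thesis
    by (rule that)
qed

text \<open>The formal variable is 1/t, so the two terms sit at the distinct indices 0 and
  \<open>-m\<close>.\<close>

lemma fls_X_inv_power_independent: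
  assumes "of_int x + fls_X_inv ^ m * of_int y = (0 :: 'a::comm_ring_1 fls)" "m > 0"
  shows "of_int x = (0 :: 'a fls)" "of_int y = (0 :: 'a fls)"
proof -
  have "fls_const (of_int x) + fls_shift (int m) (fls_const (of_int y)) = (0 :: 'a fls)"
    using assms by (simp add: fls_of_int fls_X_inv_power_times_conv_shift)
  hence eq: "fls_nth (fls_const (of_int x) + fls_shift (int m) (fls_const (of_int y))) i = (0 :: 'a)" for i
    by simp
  show "of_int x = (0 :: 'a fls)" "of_int y = (0 :: 'a fls)"
    using eq[of 0] eq[of "- int m"] \<open>m > 0\<close> by (simp_all add: fls_of_int)
qed

section \<open>The matrix of the Atkin operator on a class with two elements\<close>

text \<open>The class is the progression \<open>j, j + m, j + 2 * m, ...\<close> with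
  \<open>m = q - 1\<close>, cut off at \<open>k - 2\<close>. The resulting bounds later leave a
  single \<open>h\<close> in the sum for each image.\<close>

lemma class_indices_two:
  assumes q: "q \<ge> 2" and j: "j \<le> q - 2" and two: "card (class_indices q k j) = 2"
  shows "class_indices q k j = {j, j + (q - 1)}"
    and "j + (q - 1) \<le> k - 2" and "k - 2 < j + 2 * (q - 1)"
proof -
  define m where "m = q - 1"
  have m: "m > 0" "j < m"
    using q j by (auto simp: m_def)
  have I: "class_indices q k j = {l. l \<le> k - 2 \<and> l mod m = j}"
    using m by (auto simp: class_indices_def m_def)
  have fin: "finite (class_indices q k j)"
    by (simp add: I)
  have sub: "l \<in> {j, j + m}" if "l mod m = j" "l < j + 2 * m" for l
  proof -
    have l: "l = j + m * (l div m)"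
      using that(1) by (metis mod_mult_div_eq)
    hence "m * (l div m) < m * 2"
      using that(2) by linarith
    hence "l div m < 2"
      by simp
    thus ?thesis
      using l by (auto simp: less_2_cases_iff)
  qed
  show upper: "k - 2 < j + 2 * (q - 1)"
  proof (rule ccontr)
    assume "\<not> k - 2 < j + 2 * (q - 1)"
    hence "j + 2 * m \<le> k - 2"
      by (simp add: m_def)
    hence "{j, j + m, j + 2 * m} \<subseteq> class_indices q k j"
      using m unfolding I by auto
    from card_mono[OF fin this] show False
      using m two by simp
  qed
  show lower: "j + (q - 1) \<le> k - 2"
  proof (rule ccontr)
    assume "\<not> j + (q - 1) \<le> k - 2"
    hence "k - 2 < j + m"
      by (simp add: m_def)
    hence "class_indices q k j \<subseteq> {j}"
      using sub unfolding I by fastforce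
    from card_mono[OF _ this] show False
      using two by simp
  qed
  have "class_indices q k j \<subseteq> {j, j + m}"
  proof
    fix l assume "l \<in> class_indices q k j"
    hence "l mod m = j" "l < j + 2 * m"
      using upper unfolding I m_def by simp_all
    thus "l \<in> {j, j + m}"
      by (rule sub)
  qed
  moreover have "{j, j + m} \<subseteq> class_indices q k j"
    using lower[folded m_def] m(2) unfolding I by auto
  ultimately show "class_indices q k j = {j, j + (q - 1)}"
    unfolding m_def by (rule equalityI)
qed

lemma ibinom_of_nat [simp]: "ibinom (int a) (int b) = a choose b"
  by (simp add: ibinom_def binomial_eq_0)

lemma ibinom_of_nat_add [simp]:
  "ibinom (int a + int a') (int b) = (a + a') choose b"
  "ibinom (int a + int a') (int b + int b') = (a + a') choose (b + b')"
  using ibinom_of_nat[of "a + a'" b] ibinom_of_nat[of "a + a'" "b + b'"] by simp_all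

lemma atkin_formula_lower:
  fixes \<iota> :: "'a::{field,finite} fls \<Rightarrow> 'c::field"
  defines "m \<equiv> CARD('a) - 1"
  assumes k: "k \<ge> 2" and j: "j < m" and km: "j + m \<le> k - 2" "k - 2 < j + 2 * m"
  shows "atkin_formula \<iota> k c j =
           fscale (- ((- t_C \<iota>) ^ (j + 1)) * of_nat ((k - 2 - j) choose j)) (c j)
           + fscale (- (t_C \<iota> ^ (j + 1)) * ((-1) ^ (j + 1) * of_nat ((k - 2 - j - m) choose j))) (c (j + m))"
proof -
  have q: "int CARD('a) - 1 = int m"
    using j unfolding m_def by linarith
  have H: "{h::int. h \<noteq> 0 \<and> 0 \<le> int j + h * int m \<and> int j + h * int m \<le> int k - 2} = {1}" (is "?H = _")
  proof (intro equalityI subsetI)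
    fix h assume h: "h \<in> ?H"
    hence "0 \<le> int j + h * int m" "int j + h * int m \<le> int k - 2"
      by auto
    hence "(-1) * int m < h * int m" "h * int m < 2 * int m"
      using j km k by linarith+
    hence "-1 < h" "h < 2"
      by (auto simp only: mult_less_cancel_right)
    thus "h \<in> {1}"
      using h by auto
  qed (use j km k in auto)
  obtain l where l: "k = l + m + j + 2"
    using k km(1) by (intro that[of "k - 2 - j - m"]) simp
  \<comment> \<open>For \<open>h = 1\<close> the first binomial in the bracket has a negative lower
    index, so only the second one remains.\<close>
  have neg: "ibinom n (- int m) = 0" for n
    using j by (simp add: ibinom_def)
  show ?thesis
    unfolding atkin_formula_def Let_def q H
    by (simp add: l neg nat_add_distrib fun_eq_iff fscale_def)
qed

lemma atkin_formula_upper: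
  fixes \<iota> :: "'a::{field,finite} fls \<Rightarrow> 'c::field"
  defines "m \<equiv> CARD('a) - 1"
  assumes k: "k \<ge> 2" and j: "j < m" and km: "j + m \<le> k - 2" "k - 2 < j + 2 * m"
  shows "atkin_formula \<iota> k c (j + m) =
           fscale (- (t_C \<iota> ^ (j + m + 1)) * (of_nat ((k - 2 - j) choose m)
             + (-1) ^ (j + m + 1) * of_nat ((k - 2 - j) choose (j + m)))) (c j) + fscale 0 (c (j + m))"
proof -
  have q: "int CARD('a) - 1 = int m"
    using j unfolding m_def by linarith
  have H: "{h::int. h \<noteq> 0 \<and> 0 \<le> int (j + m) + h * int m \<and> int (j + m) + h * int m \<le> int k - 2} = {-1}"
    (is "?H = _")
  proof (intro equalityI subsetI)
    fix h assume h: "h \<in> ?H"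
    hence "0 \<le> int (j + m) + h * int m" "int (j + m) + h * int m \<le> int k - 2"
      by auto
    hence "(-2) * int m < h * int m" "h * int m < 1 * int m"
      using j km k by linarith+
    hence "-2 < h" "h < 1"
      by (auto simp only: mult_less_cancel_right)
    thus "h \<in> {-1}"
      using h by auto
  qed (use j km k in auto)
  obtain l where l: "k = l + m + j + 2"
    using k km(1) by (intro that[of "k - 2 - j - m"]) simp
  \<comment> \<open>The bound \<open>k - 2 < j + 2 * m\<close> means \<open>l < m\<close>. This is
    the vanishing diagonal coefficient.\<close>
  have zero: "ibinom (int l) (int j + int m) = 0"
    using km by (simp add: l ibinom_def)
  show ?thesis
    unfolding atkin_formula_def Let_def q H
    by (simp add: l zero fun_eq_iff fscale_def)
qed

lemma (in vector_space) representation_pair: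
  assumes "independent {v, w}" "v \<noteq> w"
  shows "representation {v, w} (scale x v + scale y w) v = x"
    and "representation {v, w} (scale x v + scale y w) w = y"
  using assms by (auto simp: representation_add representation_scale representation_basis span_base span_scale)

theorem theorem1p1:
  fixes \<iota> :: "'a::{field,finite} fls \<Rightarrow> 'c::field"
    and av :: "'c \<Rightarrow> real"
    and c :: "nat \<Rightarrow> 'c \<Rightarrow> 'c"
    and p r q k j :: nat
  assumes C_infinity: "is_C_infinity \<iota> av"
    and p: "prime p" and q: "q = p ^ r" "CARD('a) = q"
    and k: "k \<ge> 2"
    and basis: "Teitelbaum_basis \<iota> av k c"
    and formula: "\<And>i. i \<le> k - 2 \<Longrightarrow> atkin_U \<iota> (c i) = atkin_formula \<iota> k c i"
    and j: "j \<le> q - 2"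
    and two: "card (class_indices q k j) = 2"
    and not_exceptional:
      "\<not> (even q \<and> odd k \<and>
          atkin_matrix \<iota> k c j $$ (0,0) = 0 \<and> atkin_matrix \<iota> k c j $$ (1,1) = 0)"
  shows "diagonalizable_mat (atkin_matrix \<iota> k c j)"
proof -
  interpret field_hom \<iota>
    using C_infinity by (rule is_C_infinity_field_hom)
  have "card {0, 1 :: 'a} \<le> CARD('a)"
    by (intro card_mono) auto
  hence q2: "q \<ge> 2"
    using q by simp
  have char: "CHAR('c) = p"
    using CHAR_eq_if_CARD_prime_power[of p r, where 'a = 'a] p q CHAR_hom by simp
  define m T K where "m = q - 1" and "T = t_C \<iota>" and "K = k - 2 - j"
  note I = class_indices_two[OF q2 j two, folded m_def]
  have m: "m > 0" "j < m" "m \<le> K" "K < 2 * m" "CARD('a) - 1 = m" "j + q = j + m + 1"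
    using q2 q j I(2,3) by (auto simp: m_def K_def)

  define M where "M = atkin_matrix \<iota> k c j"
  define \<alpha> \<gamma> where "\<alpha> = K choose j" and "\<gamma> = (K - m) choose j"
  \<comment> \<open>An integer can be read both in \<open>'a fls\<close>, where powers of t are
    compared, and in \<open>'c\<close>.\<close>
  define \<beta> where "\<beta> = int (K choose m) + (-1) ^ (j + m + 1) * int (K choose (j + m))"

  have ls: "sorted_list_of_set {j, j + m} = [j, j + m]"
    using sorted_list_of_set_sort_remdups[of "[j, j + m]"] m(1) by simp
  have neq: "c j \<noteq> c (j + m)"
    using basis m(1) I(2) unfolding Teitelbaum_basis_def inj_on_def by force
  have "c ` {j, j + m} \<subseteq> c ` {..k - 2}"
    using I(2) by auto
  hence indep: "funs.independent {c j, c (j + m)}"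
    using basis funs.independent_mono[of "c ` {..k - 2}" "c ` {j, j + m}"]
    unfolding Teitelbaum_basis_def by simp
  have lower: "atkin_U \<iota> (c j) = fscale (- ((- T) ^ (j + 1)) * of_nat \<alpha>) (c j)
      + fscale (- (T ^ (j + 1)) * ((-1) ^ (j + 1) * of_nat \<gamma>)) (c (j + m))"
    using atkin_formula_lower[where 'a = 'a, unfolded m(5), OF k m(2) I(2,3)] formula[of j] I(2)
    by (simp add: T_def \<alpha>_def \<gamma>_def K_def)
  have upper: "atkin_U \<iota> (c (j + m)) = fscale (- (T ^ (j + m + 1)) * of_int \<beta>) (c j)
      + fscale 0 (c (j + m))"
    using atkin_formula_upper[where 'a = 'a, unfolded m(5), OF k m(2) I(2,3)] formula[of "j + m"] I(2)
    by (simp add: T_def \<beta>_def K_def)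

  have M: "M \<in> carrier_mat 2 2"
    using two q(2) by (simp add: M_def atkin_matrix_def Let_def)
  have coords: "funs.representation {c j, c (j + m)} (atkin_U \<iota> (c j)) (c j)
      = - ((- T) ^ (j + 1)) * of_nat \<alpha>"
    "funs.representation {c j, c (j + m)} (atkin_U \<iota> (c j)) (c (j + m))
      = - (T ^ (j + 1)) * ((-1) ^ (j + 1) * of_nat \<gamma>)"
    "funs.representation {c j, c (j + m)} (atkin_U \<iota> (c (j + m))) (c j)
      = - (T ^ (j + m + 1)) * of_int \<beta>"
    "funs.representation {c j, c (j + m)} (atkin_U \<iota> (c (j + m))) (c (j + m)) = 0"
    unfolding lower upper by (rule funs.representation_pair[OF indep neq])+
  have entries: "M $$ (0,0) = - ((- T) ^ (j + 1)) * of_nat \<alpha>"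
    "M $$ (1,0) = - (T ^ (j + 1)) * ((-1) ^ (j + 1) * of_nat \<gamma>)"
    "M $$ (0,1) = - (T ^ (j + m + 1)) * of_int \<beta>" "M $$ (1,1) = 0"
    unfolding M_def atkin_matrix_def Let_def q(2) two
    by (simp_all add: I(1) ls coords)

  \<comment> \<open>Trace and negated determinant of \<open>M\<close>, pulled back along
    \<open>\<iota>\<close>. The eigenvalues are then \<open>x\<close> and
    \<open>\<iota> u - x\<close>.\<close>
  define u :: "'a fls" where "u = - ((- fls_X_inv) ^ (j + 1)) * of_nat \<alpha>"
  define v :: "'a fls" where
    "v = fls_X_inv ^ (j + m + 1) * fls_X_inv ^ (j + 1) * (-1) ^ (j + 1) * of_int (\<beta> * int \<gamma>)"
  have u: "M $$ (0,0) = \<iota> u" and v: "M $$ (0,1) * M $$ (1,0) = \<iota> v"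
    unfolding entries u_def v_def T_def t_C_def by (simp_all add: hom_distribs)
  obtain x where x: "x * x = \<iota> u * x + \<iota> v"
    using is_C_infinity_quadratic_root[OF C_infinity] .
  have "diagonalizable_mat M"
  proof (cases "x = \<iota> u - x")
    case False
    show ?thesis
      by (rule diagonalizable_mat_2[OF M False]) (simp_all add: entries(4) u v[symmetric] x algebra_simps del: One_nat_def)
  next
    case True
    \<comment> \<open>Substituting the double root gives discriminant zero without dividing by 2, so
      characteristic 2 is included.\<close>
    hence "\<iota> u = x + x"
      by (metis diff_add_cancel)
    moreover from this have "\<iota> v = - (x * x)"
      using x by (simp add: algebra_simps eq_neg_iff_add_eq_0)
    ultimately have "\<iota> u * \<iota> u + 4 * \<iota> v = 0"
      by (simp add: algebra_simps)
    hence "\<iota> (u * u + 4 * v) = 0"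
      by (simp add: hom_distribs)
    hence "u * u + 4 * v = 0"
      by simp
    \<comment> \<open>With the common factor \<open>t^(2 * (j + 1))\<close> removed, a constant and
      a multiple of \<open>t^m\<close> remain, and each must vanish.\<close>
    moreover have "u * u + 4 * v = (fls_X_inv ^ (j + 1)) ^ 2 *
        (of_int (int \<alpha> ^ 2) + fls_X_inv ^ m * of_int (4 * (-1) ^ (j + 1) * (\<beta> * int \<gamma>)))"
      unfolding u_def v_def
      by (simp add: power_minus[of fls_X_inv] power_add power2_eq_square algebra_simps)
    ultimately have "of_int (int \<alpha> ^ 2) +
        fls_X_inv ^ m * of_int (4 * (-1) ^ (j + 1) * (\<beta> * int \<gamma>)) = (0 :: 'a fls)"
      by simp
    note coeffs_0 = fls_X_inv_power_independent[OF this m(1)]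
    have \<alpha>: "of_nat \<alpha> = (0 :: 'c)"
      using arg_cong[OF coeffs_0(1), of \<iota>] by (simp add: hom_distribs)
    have \<beta>\<gamma>: "4 * (of_int \<beta> * of_nat \<gamma>) = (0 :: 'c)"
      using arg_cong[OF coeffs_0(2), of \<iota>] by (simp add: hom_distribs)
    note coeffs = off_diagonal_coefficients_eq[where 'c = 'c, unfolded char, OF p q(1), folded m_def,
        OF m(3,4) j \<alpha>[unfolded \<alpha>_def], folded \<gamma>_def]
    have \<beta>: "of_int \<beta> = ((-1) ^ (j + q) * of_nat \<gamma> :: 'c)"
      using coeffs(1) unfolding \<beta>_def m(6) by simp
    \<comment> \<open>For odd p, \<open>4 * \<beta> * \<gamma>\<close> is four times a signed square
      of \<open>\<gamma>\<close>. For \<open>p = 2\<close> that product carries no information; the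
      vanishing diagonal and \<open>not_exceptional\<close> make \<open>k\<close> even, hence
      \<open>K + j = k - 2\<close> even.\<close>
    have \<gamma>: "of_nat \<gamma> = (0 :: 'c)"
    proof (cases "p = 2")
      case True
      hence "even q"
        using q q2 by (cases r) auto
      moreover have "M $$ (0,0) = 0" "M $$ (1,1) = 0"
        by (simp_all add: entries \<alpha> del: One_nat_def)
      ultimately have "even k"
        using not_exceptional unfolding M_def by blast
      moreover have "K + j = k - 2"
        using I(2) by (simp add: K_def)
      ultimately show ?thesis
        using coeffs(2) \<open>even q\<close> k by simp
    next
      case False
      have "\<not> p dvd 2"
        using False p primes_dvd_imp_eq[of p 2] by auto
      hence "of_nat 2 \<noteq> (0 :: 'c)"
        by (simp only: of_nat_eq_0_iff_char_dvd char not_False_eq_True)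
      hence two: "2 \<noteq> (0 :: 'c)"
        by simp
      have four: "(4 :: 'c) = 2 * 2"
        by simp
      show ?thesis
        using \<beta>\<gamma> two unfolding \<beta> four mult_eq_0_iff by auto
    qed
    hence "M $$ (0,1) = 0" "M $$ (1,0) = 0"
      using \<beta> entries(2,3) by simp_all
    thus ?thesis
      using M by (intro diagonalizable_mat_diagonal[of M 2]) (auto simp: diagonal_mat_def less_2_cases_iff)
  qed
  thus ?thesis
    by (simp add: M_def)
qed

end
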